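(* Let $\mathcal{H}_u$ be a separable Hilbert space equipped with the Gaussian measure $\mu_0=\mathcal{N}(0,\mathcal{C}_0)$ and let $\mathcal{H}$ be the Cameron-Martin space of $\mu_0$. Let $\{\phi_i\}_{i=1}^M$ be the first $M$ (orthonormal in $\mathcal{H}_u$) eigenfunctions of $\mathcal{C}_0$, and define $\mathcal{P}:\mathcal{H}_u\to\mathbb{R}^M$ and $\mathcal{Q}:\mathbb{R}^M\to\mathcal{H}_u$ by $$\mathcal{P}u=(\langle u,\phi_1\rangle_{\mathcal{H}_u},\ldots,\langle u,\phi_M\rangle_{\mathcal{H}_u})^T,\qquad \mathcal{Q}d=\sum_{i=1}^M d_i\phi_i .$$ For $n=1,\ldots,N$ let $R_n$ be a real $M\times M$ matrix, $b_n\in\mathbb{R}^M$, and $$f_{\theta_n}^{(n)}(u)=u+\mathcal{F}_{\theta_n}^{(n)}(u),\qquad \mathcal{F}_{\theta_n}^{(n)}(u)=\mathcal{Q}R_n(\mathcal{P}u+b_n),\qquad u\in\mathcal{H}_u .$$ Assume that for all $n=1,\ldots,N$: $\mathrm{Im}(\mathcal{Q})\subset\mathcal{H}$, and no element of the point spectrum of $R_n$ lies in $(-\infty,-1]$. Then for all $n=1,\ldots,N$: (1) $\mathrm{Im}(\mathcal{F}_{\theta_n}^{(n)})\subset\mathcal{H}$; (2) $\mathcal{F}_{\theta_n}^{(n)}$ has finite dimensional range; (3) $f_{\theta_n}^{(n)}:\mathcal{H}_u\to\mathcal{H}_u$ is bijective; (4) for any $u\in\mathcal{H}_u$, no element of the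 point spectrum of the Fréchet derivative $D\mathcal{F}_{\theta_n}^{(n)}(u)$ lies in $(-\infty,-1]$.
   Context: "Finite dimensional range" means the image is contained in a finite-dimensional linear subspace. The parameters of the layer are $\theta_n=\{R_n,b_n\}$. The Cameron-Martin space $\mathcal{H}\subset\mathcal{H}_u$ of $\mathcal{N}(0,\mathcal{C}_0)$ carries the inner product $\langle u,v\rangle_{\mathcal{H}}=\langle\mathcal{C}_0^{-1/2}u,\mathcal{C}_0^{-1/2}v\rangle_{\mathcal{H}_u}$. *)

theory Defs
  imports "HOL-Probability.Probability"
begin

section \<open>Gaussian measures on a separable Hilbert space\<close>

text \<open>
  A separable real Hilbert space is a type of sort \<open>{real_inner, polish_space}\<close>: the class
  \<open>polish_space\<close> adds completeness and second countability, which for a metric space is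
  separability.
\<close>

text \<open>The normal law with mean \<open>m\<close> and standard deviation \<open>s\<close>; a point mass for \<open>s = 0\<close>.\<close>

definition normal_law :: "real \<Rightarrow> real \<Rightarrow> real measure" where
  "normal_law m s =
     (if s = 0 then return borel m else density lborel (\<lambda>x. ennreal (normal_density m s x)))"

definition gaussian :: "'a::{real_inner, polish_space} measure \<Rightarrow> bool" where
  "gaussian \<mu> \<longleftrightarrow> prob_space \<mu> \<and> sets \<mu> = sets borel \<and>
     (\<forall>v. \<exists>m s. 0 \<le> s \<and> distr \<mu> borel (\<lambda>u. u \<bullet> v) = normal_law m s)"

text \<open>
  \<open>gaussian_measure m C \<mu>\<close> says that \<open>\<mu>\<close> is the Gaussian measure with mean \<open>m\<close> and covariance
  operator \<open>C\<close>. All integrals exist since the one-dimensional marginals are normal;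
  that \<open>C\<close> is self-adjoint, positive and trace class is a consequence.
\<close>

definition gaussian_measure ::
  "'a::{real_inner, polish_space} \<Rightarrow> ('a \<Rightarrow> 'a) \<Rightarrow> 'a measure \<Rightarrow> bool" where
  "gaussian_measure m C \<mu> \<longleftrightarrow> gaussian \<mu> \<and>
     (\<forall>v. (\<integral>u. u \<bullet> v \<partial>\<mu>) = m \<bullet> v) \<and>
     bounded_linear C \<and>
     (\<forall>v w. (\<integral>u. ((u - m) \<bullet> v) * ((u - m) \<bullet> w) \<partial>\<mu>) = C v \<bullet> w)"

section \<open>The Cameron--Martin space\<close>

definition positive_op :: "('a::real_inner \<Rightarrow> 'a) \<Rightarrow> bool" where
  "positive_op T \<longleftrightarrow> bounded_linear T \<and> (\<forall>v w. T v \<bullet> w = v \<bullet> T w) \<and> (\<forall>v. 0 \<le> T v \<bullet> v)"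

text \<open>On a Hilbert space a positive operator has exactly one positive square root.\<close>

definition op_sqrt :: "('a::{real_inner, complete_space} \<Rightarrow> 'a) \<Rightarrow> 'a \<Rightarrow> 'a" where
  "op_sqrt C = (THE S. positive_op S \<and> S \<circ> S = C)"

text \<open>
  \<open>C\<close> need not be injective, so its inverse square root is the inverse of the square root
  restricted to the orthogonal complement of its kernel.
\<close>

definition op_inv_sqrt :: "('a::{real_inner, complete_space} \<Rightarrow> 'a) \<Rightarrow> 'a \<Rightarrow> 'a" where
  "op_inv_sqrt C u = (THE w. op_sqrt C w = u \<and> (\<forall>k. op_sqrt C k = 0 \<longrightarrow> w \<bullet> k = 0))"

text \<open>
  The underlying set of the Cameron--Martin space of a centred Gaussian measure with covariance
  \<open>C\<close> is the domain of the inverse square root of \<open>C\<close>.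
\<close>

definition cameron_martin_space :: "('a::{real_inner, complete_space} \<Rightarrow> 'a) \<Rightarrow> 'a set" where
  "cameron_martin_space C = range (op_sqrt C)"

definition cameron_martin_inner ::
  "('a::{real_inner, complete_space} \<Rightarrow> 'a) \<Rightarrow> 'a \<Rightarrow> 'a \<Rightarrow> real" where
  "cameron_martin_inner C u v = op_inv_sqrt C u \<bullet> op_inv_sqrt C v"

section \<open>Spectrum and eigenfunctions\<close>

text \<open>
  Real eigenvalues only: a real number is an eigenvalue of the complexification of \<open>T\<close> iff it is
  an eigenvalue of \<open>T\<close>, so intersections with real intervals are unaffected.
\<close>

definition point_spectrum :: "('a::real_vector \<Rightarrow> 'a) \<Rightarrow> real set" where
  "point_spectrum T = {l. \<exists>v. v \<noteq> 0 \<and> T v = l *\<^sub>R v}"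

text \<open>
  The index type stands for \<open>{1..M}\<close> with its order. The family is orthonormal and belongs to
  the \<open>M\<close> largest eigenvalues, counted with multiplicity and listed in decreasing order: no
  eigenfunction orthogonal to the whole family has a larger eigenvalue.
\<close>

definition first_eigenfunctions ::
  "('a::real_inner \<Rightarrow> 'a) \<Rightarrow> ('m::{finite, linorder} \<Rightarrow> 'a) \<Rightarrow> bool" where
  "first_eigenfunctions C \<phi> \<longleftrightarrow>
     (\<forall>i j. \<phi> i \<bullet> \<phi> j = (if i = j then 1 else 0)) \<and>
     (\<exists>l :: 'm \<Rightarrow> real.
        (\<forall>i. C (\<phi> i) = l i *\<^sub>R \<phi> i) \<and>
        (\<forall>i j. i \<le> j \<longrightarrow> l j \<le> l i) \<and>
        (\<forall>\<psi> k. \<psi> \<noteq> 0 \<and> C \<psi> = k *\<^sub>R \<psi> \<and> (\<forall>i. \<psi> \<bullet> \<phi> i = 0) \<longrightarrow> (\<forall>i. k \<le> l i)))"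

section \<open>The residual layers\<close>

definition coeff_op :: "('m::finite \<Rightarrow> 'a::real_inner) \<Rightarrow> 'a \<Rightarrow> real ^ 'm" where
  "coeff_op \<phi> u = (\<chi> i. u \<bullet> \<phi> i)"

definition synth_op :: "('m::finite \<Rightarrow> 'a::real_inner) \<Rightarrow> real ^ 'm \<Rightarrow> 'a" where
  "synth_op \<phi> d = (\<Sum>i\<in>UNIV. (d $ i) *\<^sub>R \<phi> i)"

definition layer_residual ::
  "('m::finite \<Rightarrow> 'a::real_inner) \<Rightarrow> real ^ 'm ^ 'm \<Rightarrow> real ^ 'm \<Rightarrow> 'a \<Rightarrow> 'a" where
  "layer_residual \<phi> R b u = synth_op \<phi> (R *v (coeff_op \<phi> u + b))"

definition layer_map ::
  "('m::finite \<Rightarrow> 'a::real_inner) \<Rightarrow> real ^ 'm ^ 'm \<Rightarrow> real ^ 'm \<Rightarrow> 'a \<Rightarrow> 'a" where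
  "layer_map \<phi> R b u = u + layer_residual \<phi> R b u"

definition finite_dim_range :: "('b \<Rightarrow> 'a::real_vector) \<Rightarrow> bool" where
  "finite_dim_range F \<longleftrightarrow>
     (\<exists>V. subspace V \<and> (\<exists>B. finite B \<and> V = span B) \<and> range F \<subseteq> V)"

end

theory Submission
  imports Defs
begin

text \<open>
  Since the eigenfunctions are orthonormal, the coefficient map \<open>P\<close> is a left inverse of the
  synthesis map \<open>Q\<close>. Applying \<open>P\<close> to \<open>u + Q R (P u + b) = w\<close> gives
  \<open>(I + R) (P u) = P w - R b\<close>, an equation in \<open>\<real>\<^sup>M\<close> that is uniquely solvable because
  \<open>-1\<close> is not an eigenvalue of \<open>R\<close>; then \<open>u = w - Q R (P u + b)\<close> is determined by \<open>P u\<close>.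
  In the same way, \<open>P\<close> carries an eigenvector of the derivative \<open>Q R P\<close> with a nonzero
  eigenvalue to an eigenvector of \<open>R\<close> with the same eigenvalue.
\<close>

text \<open>The domain may be infinite-dimensional, so linearity alone does not give continuity. A
  finite sum of inner products with fixed vectors is bounded.\<close>

lemma bounded_linear_coeff_op: "bounded_linear (coeff_op \<phi>)"
proof -
  have "bounded_linear (\<lambda>u. \<Sum>i\<in>UNIV. (u \<bullet> \<phi> i) *\<^sub>R axis i (1::real))"
    by (intro bounded_linear_sum bounded_linear_scaleR_const bounded_linear_inner_left)
  moreover have "coeff_op \<phi> = (\<lambda>u. \<Sum>i\<in>UNIV. (u \<bullet> \<phi> i) *\<^sub>R axis i (1::real))"
    by (auto simp: coeff_op_def vec_eq_iff sum_component axis_def if_distrib cong: if_cong)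
  ultimately show ?thesis by simp
qed

lemma linear_synth_op: "linear (synth_op \<phi>)"
  by (rule linearI)
     (simp_all add: synth_op_def sum.distrib scaleR_left_distrib scaleR_sum_right)

lemma synth_op_in_span: "synth_op \<phi> d \<in> span (range \<phi>)"
  unfolding synth_op_def by (intro span_sum span_scale span_base) simp

lemma coeff_op_synth_op:
  assumes "\<And>i j. \<phi> i \<bullet> \<phi> j = (if i = j then 1 else 0)"
  shows "coeff_op \<phi> (synth_op \<phi> d) = d"
  by (simp add: coeff_op_def synth_op_def vec_eq_iff inner_sum_left assms if_distrib cong: if_cong)

lemma finite_dim_range_layer_residual:
  "finite_dim_range (layer_residual \<phi> R b)"
  unfolding finite_dim_range_def layer_residual_def
  by (rule exI[of _ "span (range \<phi>)"]) (auto intro: synth_op_in_span exI[of _ "range \<phi>"])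

text \<open>The residual is affine, so its derivative at every point is the linear part
  \<open>Q R P\<close>. The factor \<open>Q R\<close> is bounded because its domain is
  finite-dimensional.\<close>

lemma layer_residual_has_derivative:
  "(layer_residual \<phi> R b has_derivative (\<lambda>v. synth_op \<phi> (R *v coeff_op \<phi> v))) (at u)"
proof -
  have "bounded_linear (\<lambda>v. synth_op \<phi> (R *v v))"
    using linear_compose[OF matrix_vector_mul_linear linear_synth_op]
    by (simp add: o_def linear_conv_bounded_linear)
  moreover have "((\<lambda>v. coeff_op \<phi> v + b) has_derivative coeff_op \<phi>) (at u)"
    by (intro has_derivative_add_const bounded_linear_imp_has_derivative bounded_linear_coeff_op)
  ultimately show ?thesis
    unfolding layer_residual_def by (rule bounded_linear.has_derivative)
qed

text \<open>The value 0 has to be allowed: any nonzero vector orthogonal to all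
  \<open>\<phi> i\<close> is killed by \<open>Q R P\<close>, even when \<open>R\<close> is
  invertible.\<close>

lemma point_spectrum_synth_coeff_subset:
  assumes "\<And>i j. \<phi> i \<bullet> \<phi> j = (if i = j then 1 else 0)"
  shows "point_spectrum (\<lambda>v. synth_op \<phi> (R *v coeff_op \<phi> v)) \<subseteq> insert 0 (point_spectrum ((*v) R))"
proof
  fix l assume "l \<in> point_spectrum (\<lambda>v. synth_op \<phi> (R *v coeff_op \<phi> v))"
  then obtain v where v: "v \<noteq> 0" "synth_op \<phi> (R *v coeff_op \<phi> v) = l *\<^sub>R v"
    by (auto simp: point_spectrum_def)
  have "R *v coeff_op \<phi> v = coeff_op \<phi> (l *\<^sub>R v)"
    by (metis v(2) coeff_op_synth_op[OF assms])
  also have "\<dots> = l *\<^sub>R coeff_op \<phi> v"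
    by (rule linear_scale[OF bounded_linear.linear[OF bounded_linear_coeff_op]])
  finally have "R *v coeff_op \<phi> v = l *\<^sub>R coeff_op \<phi> v" .
  \<comment> \<open>If \<open>P v = 0\<close>, then \<open>l v = Q R 0 = 0\<close>, which is
    impossible for nonzero \<open>l\<close> and \<open>v\<close>.\<close>
  moreover have "coeff_op \<phi> v \<noteq> 0" if "l \<noteq> 0"
    using v that by (auto simp: linear_0[OF linear_synth_op])
  ultimately show "l \<in> insert 0 (point_spectrum ((*v) R))"
    by (auto simp: point_spectrum_def)
qed

text \<open>A nonzero kernel vector of \<open>I + R\<close> would be an eigenvector of
  \<open>R\<close> for -1; in finite dimension, injectivity then gives surjectivity.\<close>

lemma bij_id_plus_matrix:
  fixes R :: "real ^ 'm ^ 'm"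
  assumes "-1 \<notin> point_spectrum ((*v) R)"
  shows "bij (\<lambda>d. d + R *v d)"
proof -
  have lin: "linear (\<lambda>d. d + R *v d)"
    by (intro linear_compose_add linear_id[unfolded id_def] matrix_vector_mul_linear)
  moreover have "inj (\<lambda>d. d + R *v d)"
    using assms by (auto simp: linear_injective_0[OF lin] point_spectrum_def eq_neg_iff_add_eq_0 add.commute)
  ultimately show ?thesis
    by (simp add: bij_def linear_injective_imp_surjective)
qed

lemma bij_layer_map:
  assumes orth: "\<And>i j. \<phi> i \<bullet> \<phi> j = (if i = j then 1 else 0)"
    and "-1 \<notin> point_spectrum ((*v) R)"
  shows "bij (layer_map \<phi> R b)"
proof -
  note P_add = linear_add[OF bounded_linear.linear[OF bounded_linear_coeff_op]]
  note P_diff = linear_diff[OF bounded_linear.linear[OF bounded_linear_coeff_op]]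
  have bij: "bij (\<lambda>d. d + R *v d)"
    by (rule bij_id_plus_matrix) fact
  have coeff_layer_map: "coeff_op \<phi> (layer_map \<phi> R b u) = (coeff_op \<phi> u + R *v coeff_op \<phi> u) + R *v b" for u
    by (simp add: layer_map_def layer_residual_def P_add coeff_op_synth_op[OF orth]
        matrix_vector_right_distrib)
  have "inj (layer_map \<phi> R b)"
  proof (rule injI)
    fix u w assume eq: "layer_map \<phi> R b u = layer_map \<phi> R b w"
    then have "coeff_op \<phi> u + R *v coeff_op \<phi> u = coeff_op \<phi> w + R *v coeff_op \<phi> w"
      by (metis coeff_layer_map add_right_cancel)
    then have "coeff_op \<phi> u = coeff_op \<phi> w"
      using bij_is_inj[OF bij] by (auto dest: injD)
    \<comment> \<open>The residual depends on its argument only through the coefficients, so equal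
      residuals cancel in \<open>eq\<close>.\<close>
    then show "u = w"
      using eq by (simp add: layer_map_def layer_residual_def)
  qed
  moreover have "surj (layer_map \<phi> R b)"
  proof (rule surjI)
    fix w
    \<comment> \<open>By \<open>coeff_layer_map\<close>, this is the only possible coefficient
      vector of a preimage of \<open>w\<close>.\<close>
    define d where "d = inv (\<lambda>d. d + R *v d) (coeff_op \<phi> w - R *v b)"
    have "d + R *v d = coeff_op \<phi> w - R *v b"
      unfolding d_def using surj_f_inv_f[OF bij_is_surj[OF bij]] .
    \<comment> \<open>The candidate preimage has coefficients \<open>d\<close>, so the layer adds
      back exactly what was subtracted from \<open>w\<close>.\<close>
    then have "coeff_op \<phi> (w - synth_op \<phi> (R *v (d + b))) = d"
      by (simp add: P_diff coeff_op_synth_op[OF orth] matrix_vector_right_distrib algebra_simps)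
    then show "layer_map \<phi> R b (w - synth_op \<phi> (R *v
        (inv (\<lambda>d. d + R *v d) (coeff_op \<phi> w - R *v b) + b))) = w"
      by (simp add: layer_map_def layer_residual_def d_def)
  qed
  ultimately show ?thesis
    by (simp add: bij_def)
qed

theorem theorem2p5:
  fixes \<mu>\<^sub>0 :: "'a::{real_inner, polish_space} measure"
    and C\<^sub>0 :: "'a \<Rightarrow> 'a"
    and \<phi> :: "'m::{finite, linorder} \<Rightarrow> 'a"
    and N :: nat
    and R :: "nat \<Rightarrow> real ^ ('m::{finite, linorder}) ^ ('m::{finite, linorder})"
    and b :: "nat \<Rightarrow> real ^ ('m::{finite, linorder})"
  assumes "gaussian_measure 0 C\<^sub>0 \<mu>\<^sub>0"
    and "first_eigenfunctions C\<^sub>0 \<phi>"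
    and "range (synth_op \<phi>) \<subseteq> cameron_martin_space C\<^sub>0"
    and "\<forall>n\<in>{1..N}. point_spectrum ((*v) (R n)) \<inter> {..-1} = {}"
  shows "\<forall>n\<in>{1..N}.
      range (layer_residual \<phi> (R n) (b n)) \<subseteq> cameron_martin_space C\<^sub>0 \<and>
      finite_dim_range (layer_residual \<phi> (R n) (b n)) \<and>
      bij (layer_map \<phi> (R n) (b n)) \<and>
      (\<forall>u. layer_residual \<phi> (R n) (b n) differentiable (at u) \<and>
           point_spectrum (frechet_derivative (layer_residual \<phi> (R n) (b n)) (at u)) \<inter> {..-1} = {})"
proof (intro ballI conjI allI)
  fix n u assume "n \<in> {1..N}"
  then have spec: "point_spectrum ((*v) (R n)) \<inter> {..-1} = {}"
    using assms(4) by blast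
  have orth: "\<phi> i \<bullet> \<phi> j = (if i = j then 1 else 0)" for i j
    using assms(2) by (simp add: first_eigenfunctions_def)
  show "range (layer_residual \<phi> (R n) (b n)) \<subseteq> cameron_martin_space C\<^sub>0"
    using assms(3) by (auto simp: layer_residual_def)
  show "finite_dim_range (layer_residual \<phi> (R n) (b n))"
    by (rule finite_dim_range_layer_residual)
  show "bij (layer_map \<phi> (R n) (b n))"
    using spec by (intro bij_layer_map orth) auto
  show "layer_residual \<phi> (R n) (b n) differentiable (at u)"
    using layer_residual_has_derivative by (rule differentiableI)
  have "frechet_derivative (layer_residual \<phi> (R n) (b n)) (at u)
      = (\<lambda>v. synth_op \<phi> (R n *v coeff_op \<phi> v))"
    by (rule frechet_derivative_at[OF layer_residual_has_derivative, symmetric])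
  \<comment> \<open>The possible extra eigenvalue 0 lies outside \<open>{..-1}\<close>.\<close>
  then show "point_spectrum (frechet_derivative (layer_residual \<phi> (R n) (b n)) (at u)) \<inter> {..-1} = {}"
    using spec point_spectrum_synth_coeff_subset[of \<phi> "R n", OF orth] by fastforce
qed

end
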